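(* Let $S=\{132,231\}$. For integers $c\ge0$ and $n\ge2$ with $n>c$, $$f_S(n,c,x)=f_S(n-1,c+1,x)+x^{\triangle}f_S(n-1,c,x),$$ where $$\triangle=\begin{cases}1,&n\in\{c+1,c+2,\ldots,c+n-1\},\\0,&\text{otherwise}.\end{cases}$$ Also $f_S(0,c,x)=f_S(1,c,x)=1$, and $f_S(n,c,x)=2^{n-1}$ for $1\le n\le c$. In particular, $f_S(n,c,1)=2^{n-1}$ for $n\ge1$. Moreover, writing $f_S(n,x)=f_S(n,0,x)$, for $n\ge1$, $$f_S(n+3,x)=(x+1)f_S(n+2,x)-(x-2)f_S(n+1,x)-2f_S(n,x),$$ where $f_S(0,x)=1$, $f_S(1,x)=1$, $f_S(2,x)=2$ and $f_S(3,x)=x+3$.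
   Context: $\mathfrak S_n$ is the set of permutations of $\{1,\dots,n\}$. $\operatorname{Av}_n(S)$ is the set of $\pi\in\mathfrak S_n$ having no subsequence order-isomorphic to any element of $S$. For $\pi\in\mathfrak S_n$ and $c\in\mathbb Z$, the number of shifted double deficiencies of $\pi$ with shift $c$ is $$\operatorname{DD}_c(\pi)=\#\{j\in\{1,\ldots,n\}: 1\le j+c\le n,\ \pi(j)<j+c<\pi^{-1}(j+c)+c\}.$$ For $c=0$ this is the number $\operatorname{DD}(\pi)$ of double deficiencies, i.e. of indices $k$ with $\pi(k)<k<\pi^{-1}(k)$. For $n,c\ge0$, $f_S(n,c,x)=\sum_{\pi\in\operatorname{Av}_n(S)}x^{\operatorname{DD}_c(\pi)}$. *)

theory Defs
  imports
    "HOL-Combinatorics.Permutations"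
    "HOL-Library.Sublist"
    "HOL-Computational_Algebra.Polynomial"
begin

definition order_isomorphic :: "nat list \<Rightarrow> nat list \<Rightarrow> bool" where
  "order_isomorphic xs ys \<longleftrightarrow> length xs = length ys \<and>
     (\<forall>i<length xs. \<forall>j<length xs. xs ! i < xs ! j \<longleftrightarrow> ys ! i < ys ! j)"

definition one_line :: "nat \<Rightarrow> (nat \<Rightarrow> nat) \<Rightarrow> nat list" where
  "one_line n \<pi> = map \<pi> [1..<Suc n]"

text \<open>Permutations of \<open>{1..n}\<close> are functions that are the identity outside \<open>{1..n}\<close>;
  patterns are given in one-line notation. \<^const>\<open>subseq\<close> is the (not necessarily
  contiguous) subsequence relation.\<close>

definition Av :: "nat \<Rightarrow> nat list set \<Rightarrow> (nat \<Rightarrow> nat) set" where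
  "Av n S = {\<pi>. \<pi> permutes {1..n} \<and>
     \<not> (\<exists>\<sigma>\<in>S. \<exists>xs. subseq xs (one_line n \<pi>) \<and> order_isomorphic xs \<sigma>)}"

text \<open>The conversion \<^const>\<open>nat\<close> below is applied only to values in \<open>{1..n}\<close>.\<close>

definition DD :: "nat \<Rightarrow> int \<Rightarrow> (nat \<Rightarrow> nat) \<Rightarrow> nat" where
  "DD n c \<pi> = card {j \<in> {1..n}. 1 \<le> int j + c \<and> int j + c \<le> int n \<and>
     int (\<pi> j) < int j + c \<and> int j + c < int (inv \<pi> (nat (int j + c))) + c}"

text \<open>The variable \<open>x\<close> is the indeterminate \<open>[:0, 1:]\<close> of \<open>\<int>[x]\<close>.\<close>

definition f_poly :: "nat list set \<Rightarrow> nat \<Rightarrow> nat \<Rightarrow> int poly" where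
  "f_poly S n c = (\<Sum>\<pi>\<in>Av n S. [:0, 1:] ^ DD n (int c) \<pi>)"

end

theory Submission
  imports Defs
begin

text \<open>A permutation avoids \<open>132\<close> and \<open>231\<close> exactly when no entry exceeds both an entry to its left
  and an entry to its right. The largest entry of such a permutation of \<open>{1..n+1}\<close> therefore
  stands at one of the two ends, and deleting it leaves a permutation of \<open>{1..n}\<close> of the same kind;
  conversely the largest entry may be put back at either end.

  Count \<open>DD\<^sub>c\<close> by the value \<open>k = j + c\<close> instead of the position \<open>j\<close>. Putting \<open>n+1\<close> at the right end
  changes nothing for \<open>k \<le> n\<close> and makes \<open>k = n+1\<close> count exactly if \<open>1 \<le> c \<le> n\<close>. Putting it at the
  left end moves all other entries one place to the right, so \<open>DD\<^sub>c\<close> of the new permutation is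
  \<open>DD\<^sub>c\<^sub>+\<^sub>1\<close> of the old one. This is \<open>f_Suc\<close>, the recursion in \<open>n\<close> and \<open>c\<close>.

  The recursion for \<open>c = 0\<close> follows from it by algebra. For \<open>c \<ge> 1\<close> the polynomial \<open>f(c+m, c)\<close>
  depends on \<open>c\<close> only through a factor \<open>2\<^sup>c\<^sup>-\<^sup>1\<close>: it is \<open>2\<^sup>c\<^sup>-\<^sup>1 Q\<^sub>m\<close>, where \<open>Q\<^sub>m = x Q\<^sub>m\<^sub>-\<^sub>1 + 2 Q\<^sub>m\<^sub>-\<^sub>2\<close>
  (\<open>f_diagonal\<close>). At \<open>c = 0\<close> the recursion reads \<open>f(n+1, 0) - f(n, 0) = f(n, 1) = Q\<^sub>n\<^sub>-\<^sub>1\<close>, so the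
  differences of \<open>f(n, 0)\<close> satisfy the second-order recursion of \<open>Q\<close>, which is the stated third-order
  recursion for \<open>f(n, 0)\<close>.\<close>

section \<open>Permutations without an interior peak\<close>

lemma subseq_Cons_iff_nth:
  "subseq (x # xs) ys \<longleftrightarrow> (\<exists>i<length ys. ys ! i = x \<and> subseq xs (drop (Suc i) ys))"
proof
  assume "subseq (x # xs) ys"
  then obtain us v vs where "ys = us @ v # vs" "x = v" "subseq xs vs"
    by (auto dest: list_emb_ConsD)
  then show "\<exists>i<length ys. ys ! i = x \<and> subseq xs (drop (Suc i) ys)"
    by (intro exI[of _ "length us"]) auto
next
  assume "\<exists>i<length ys. ys ! i = x \<and> subseq xs (drop (Suc i) ys)"
  then obtain i where i: "i < length ys" "ys ! i = x" "subseq xs (drop (Suc i) ys)" by blast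
  then have "subseq (x # xs) (drop i ys)"
    by (metis Cons_nth_drop_Suc subseq_Cons2)
  then show "subseq (x # xs) ys"
    by (metis append_take_drop_id list_emb_append2)
qed

lemma subseq3_iff_nth:
  "subseq [a, b, c] ys \<longleftrightarrow>
     (\<exists>i j k. i < j \<and> j < k \<and> k < length ys \<and> ys ! i = a \<and> ys ! j = b \<and> ys ! k = c)"
    (is "?L \<longleftrightarrow> ?R")
proof
  assume ?L
  then obtain i j k where
    "i < length ys" "ys ! i = a"
    "j < length (drop (Suc i) ys)" "drop (Suc i) ys ! j = b"
    "k < length (drop (Suc j) (drop (Suc i) ys))" "drop (Suc j) (drop (Suc i) ys) ! k = c"
    unfolding subseq_Cons_iff_nth by blast
  then show ?R
    by (intro exI[of _ i] exI[of _ "Suc (i + j)"] exI[of _ "Suc (Suc (i + j + k))"])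
      (auto simp: add_ac)
next
  assume ?R
  then obtain i j k where ijk: "i < j" "j < k" "k < length ys"
      "ys ! i = a" "ys ! j = b" "ys ! k = c" by blast
  have "subseq [c] (drop (Suc j) ys)"
    unfolding subseq_Cons_iff_nth using ijk by (intro exI[of _ "k - Suc j"]) auto
  moreover have "Suc (j - Suc i) + Suc i = Suc j" using ijk by simp
  ultimately have "subseq [b, c] (drop (Suc i) ys)"
    unfolding subseq_Cons_iff_nth[of b] using ijk
    by (intro exI[of _ "j - Suc i"]) (auto simp: add_ac)
  then show ?L
    unfolding subseq_Cons_iff_nth[of a] using ijk by (intro exI[of _ i]) auto
qed

lemma order_isomorphic_132:
  "order_isomorphic xs [1,3,2] \<longleftrightarrow> (\<exists>a b c. xs = [a, b, c] \<and> a < c \<and> c < b)"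
  by (auto simp: order_isomorphic_def length_Suc_conv numeral_eq_Suc All_less_Suc less_Suc_eq)

lemma order_isomorphic_231:
  "order_isomorphic xs [2,3,1] \<longleftrightarrow> (\<exists>a b c. xs = [a, b, c] \<and> c < a \<and> a < b)"
  by (auto simp: order_isomorphic_def length_Suc_conv numeral_eq_Suc All_less_Suc less_Suc_eq)

definition peakless :: "nat \<Rightarrow> (nat \<Rightarrow> nat) set" where
  "peakless n = {\<pi>. \<pi> permutes {1..n} \<and>
     (\<forall>i j k. 1 \<le> i \<and> i < j \<and> j < k \<and> k \<le> n \<longrightarrow> \<not> (\<pi> i < \<pi> j \<and> \<pi> k < \<pi> j))}"

lemma subseq3_one_line:
  "subseq [a, b, c] (one_line n \<pi>) \<longleftrightarrow>
     (\<exists>i j k. 1 \<le> i \<and> i < j \<and> j < k \<and> k \<le> n \<and> \<pi> i = a \<and> \<pi> j = b \<and> \<pi> k = c)" (is "?L \<longleftrightarrow> ?R")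
proof
  assume ?L
  then obtain i j k where "i < j" "j < k" "k < n" "\<pi> (Suc i) = a" "\<pi> (Suc j) = b" "\<pi> (Suc k) = c"
    unfolding subseq3_iff_nth one_line_def by (auto simp del: upt_Suc)
  then show ?R by (intro exI[of _ "Suc i"] exI[of _ "Suc j"] exI[of _ "Suc k"]) auto
next
  assume ?R
  then obtain i j k where "1 \<le> i" "i < j" "j < k" "k \<le> n" "\<pi> i = a" "\<pi> j = b" "\<pi> k = c" by blast
  then show ?L
    unfolding subseq3_iff_nth one_line_def
    by (intro exI[of _ "i - 1"] exI[of _ "j - 1"] exI[of _ "k - 1"]) (auto simp del: upt_Suc)
qed

text \<open>The two patterns are the two ways of ordering the outer entries of a peak; these entries are
  distinct because a permutation is injective.\<close>

lemma Av_eq_peakless: "Av n {[1,3,2], [2,3,1]} = peakless n"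
proof (rule set_eqI)
  fix \<pi>
  show "\<pi> \<in> Av n {[1,3,2], [2,3,1]} \<longleftrightarrow> \<pi> \<in> peakless n"
  proof (cases "\<pi> permutes {1..n}")
    case True
    have "(\<exists>\<sigma>\<in>{[1,3,2], [2,3,1]}. \<exists>xs. subseq xs (one_line n \<pi>) \<and> order_isomorphic xs \<sigma>) \<longleftrightarrow>
        (\<exists>a b c. subseq [a, b, c] (one_line n \<pi>) \<and> (a < c \<and> c < b \<or> c < a \<and> a < b))"
      unfolding bex_simps order_isomorphic_132 order_isomorphic_231 by blast
    also have "\<dots> \<longleftrightarrow> (\<exists>i j k. 1 \<le> i \<and> i < j \<and> j < k \<and> k \<le> n \<and>
        (\<pi> i < \<pi> k \<and> \<pi> k < \<pi> j \<or> \<pi> k < \<pi> i \<and> \<pi> i < \<pi> j))"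
      unfolding subseq3_one_line by blast
    also have "\<dots> \<longleftrightarrow> (\<exists>i j k. 1 \<le> i \<and> i < j \<and> j < k \<and> k \<le> n \<and> \<pi> i < \<pi> j \<and> \<pi> k < \<pi> j)"
    proof -
      have "\<pi> i \<noteq> \<pi> k" if "i < k" for i k
        using that permutes_inj[OF True] by (metis injD less_irrefl)
      then have "(\<pi> i < \<pi> k \<and> \<pi> k < \<pi> j \<or> \<pi> k < \<pi> i \<and> \<pi> i < \<pi> j) \<longleftrightarrow> (\<pi> i < \<pi> j \<and> \<pi> k < \<pi> j)"
        if "i < j" "j < k" for i j k
        using that by (metis less_trans nat_neq_iff)
      then show ?thesis by blast
    qed
    finally show ?thesis using True unfolding Av_def peakless_def by blast
  qed (auto simp: Av_def peakless_def)
qed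

lemma finite_peakless: "finite (peakless n)"
  unfolding peakless_def by (rule finite_subset[OF _ finite_permutations[of "{1..n}"]]) auto

lemma peakless_permutes: "\<pi> \<in> peakless n \<Longrightarrow> \<pi> permutes {1..n}"
  by (simp add: peakless_def)

lemma permutes_le: "\<pi> permutes {1..n} \<Longrightarrow> i \<le> n \<Longrightarrow> \<pi> i \<le> n" for i n :: nat
  by (metis atLeastAtMost_iff permutes_in_image permutes_not_in)

section \<open>Deleting the largest entry\<close>

text \<open>Composing a permutation of \<open>{1..n}\<close> with this cycle puts \<open>n+1\<close> in front of its one-line
  notation. Putting \<open>n+1\<close> at the end changes no value of the permutation, since permutations are
  functions that fix every point outside their domain.\<close>

definition front :: "nat \<Rightarrow> nat \<Rightarrow> nat" where
  "front n j = (if j = 1 then Suc n else if 1 < j \<and> j \<le> Suc n then j - 1 else j)"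

lemma front_permutes: "front n permutes {1..Suc n}"
proof (rule bij_imp_permutes)
  show "bij_betw (front n) {1..Suc n} {1..Suc n}"
    by (rule bij_betwI[where g = "\<lambda>j. if j = Suc n then 1 else Suc j"])
      (auto simp: front_def split: if_splits)
qed (auto simp: front_def)

lemma inv_front: "1 \<le> k \<Longrightarrow> k \<le> Suc n \<Longrightarrow> inv (front n) k = (if k = Suc n then 1 else Suc k)"
  by (rule inv_f_eq[OF permutes_inj[OF front_permutes]]) (auto simp: front_def)

lemma front_1 [simp]: "front n (Suc 0) = Suc n"
  by (simp add: front_def)

lemma front_shift: "1 \<le> j \<Longrightarrow> j \<le> n \<Longrightarrow> front n (Suc j) = j"
  by (simp add: front_def)

lemma peakless_max_last: "{\<pi> \<in> peakless (Suc n). \<pi> (Suc n) = Suc n} = peakless n"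
proof (intro set_eqI iffI)
  fix \<pi> assume "\<pi> \<in> {\<pi> \<in> peakless (Suc n). \<pi> (Suc n) = Suc n}"
  then have \<pi>: "\<pi> \<in> peakless (Suc n)" "\<pi> (Suc n) = Suc n" by auto
  have "\<pi> permutes {1..n}"
    by (rule permutes_superset[OF peakless_permutes[OF \<pi>(1)]])
      (use \<pi>(2) in \<open>auto simp: le_Suc_eq\<close>)
  then show "\<pi> \<in> peakless n" using \<pi>(1) by (auto simp: peakless_def)
next
  fix \<pi> assume \<pi>: "\<pi> \<in> peakless n"
  then have p: "\<pi> permutes {1..n}" by (rule peakless_permutes)
  have fix_max: "\<pi> (Suc n) = Suc n" by (rule permutes_not_in[OF p]) simp
  moreover have "\<pi> \<in> peakless (Suc n)"
    unfolding peakless_def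
  proof (intro CollectI conjI allI impI)
    show "\<pi> permutes {1..Suc n}" using p by (rule permutes_subset) auto
    fix i j k assume ijk: "1 \<le> i \<and> i < j \<and> j < k \<and> k \<le> Suc n"
    show "\<not> (\<pi> i < \<pi> j \<and> \<pi> k < \<pi> j)"
    proof (cases "k = Suc n")
      case True
      then show ?thesis using fix_max permutes_le[OF p, of j] ijk by auto
    next
      case False
      then show ?thesis using \<pi> ijk unfolding peakless_def by auto
    qed
  qed
  ultimately show "\<pi> \<in> {\<pi> \<in> peakless (Suc n). \<pi> (Suc n) = Suc n}" by simp
qed

lemma comp_front_peakless:
  assumes \<sigma>: "\<sigma> \<in> peakless n"
  shows "\<sigma> \<circ> front n \<in> peakless (Suc n)"
  unfolding peakless_def
proof (intro CollectI conjI allI impI)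
  have p: "\<sigma> permutes {1..n}" by (rule peakless_permutes[OF \<sigma>])
  have p': "\<sigma> permutes {1..Suc n}" using p by (rule permutes_subset) auto
  show q: "\<sigma> \<circ> front n permutes {1..Suc n}" by (rule permutes_compose[OF front_permutes p'])
  fix i j k assume ijk: "1 \<le> i \<and> i < j \<and> j < k \<and> k \<le> Suc n"
  show "\<not> ((\<sigma> \<circ> front n) i < (\<sigma> \<circ> front n) j \<and> (\<sigma> \<circ> front n) k < (\<sigma> \<circ> front n) j)"
  proof (cases "i = 1")
    case True
    have "(\<sigma> \<circ> front n) i = Suc n" using True permutes_not_in[OF p, of "Suc n"] by simp
    then show ?thesis using permutes_le[OF q, of j] ijk by auto
  next
    case False
    then have "i = Suc (i - 1)" "j = Suc (j - 1)" "k = Suc (k - 1)" "1 \<le> i - 1"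
      using ijk by auto
    then obtain i' j' k' where "i = Suc i'" "j = Suc j'" "k = Suc k'" "1 \<le> i'" by blast
    then show ?thesis using \<sigma> ijk by (auto simp: peakless_def front_shift)
  qed
qed

lemma peakless_max_first:
  "{\<pi> \<in> peakless (Suc n). \<pi> 1 = Suc n} = (\<lambda>\<sigma>. \<sigma> \<circ> front n) ` peakless n"
proof (intro set_eqI iffI)
  fix \<pi> assume "\<pi> \<in> {\<pi> \<in> peakless (Suc n). \<pi> 1 = Suc n}"
  then have \<pi>: "\<pi> \<in> peakless (Suc n)" "\<pi> 1 = Suc n" by auto
  note p = peakless_permutes[OF \<pi>(1)]
  define \<sigma> where "\<sigma> = \<pi> \<circ> inv (front n)"
  have \<sigma>_val: "\<sigma> j = \<pi> (Suc j)" if "1 \<le> j" "j \<le> n" for j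
    using that by (simp add: \<sigma>_def inv_front)
  have "\<sigma> permutes {1..Suc n}"
    unfolding \<sigma>_def by (rule permutes_compose[OF permutes_inv[OF front_permutes] p])
  moreover have "\<sigma> (Suc n) = Suc n" using \<pi>(2) by (simp add: \<sigma>_def inv_front)
  ultimately have "\<sigma> permutes {1..n}"
    by - (rule permutes_superset, assumption, auto simp: le_Suc_eq)
  moreover have "\<not> (\<sigma> i < \<sigma> j \<and> \<sigma> k < \<sigma> j)" if "1 \<le> i \<and> i < j \<and> j < k \<and> k \<le> n" for i j k
  proof -
    have "1 \<le> Suc i \<and> Suc i < Suc j \<and> Suc j < Suc k \<and> Suc k \<le> Suc n" using that by simp
    then have "\<not> (\<pi> (Suc i) < \<pi> (Suc j) \<and> \<pi> (Suc k) < \<pi> (Suc j))"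
      using \<pi>(1) unfolding peakless_def by blast
    then show ?thesis using that by (simp add: \<sigma>_val)
  qed
  ultimately have "\<sigma> \<in> peakless n" unfolding peakless_def by blast
  moreover have "\<pi> = \<sigma> \<circ> front n"
    using permutes_inv_o(2)[OF front_permutes] by (simp add: \<sigma>_def comp_assoc)
  ultimately show "\<pi> \<in> (\<lambda>\<sigma>. \<sigma> \<circ> front n) ` peakless n" by blast
next
  fix \<pi> assume "\<pi> \<in> (\<lambda>\<sigma>. \<sigma> \<circ> front n) ` peakless n"
  then obtain \<sigma> where \<sigma>: "\<sigma> \<in> peakless n" "\<pi> = \<sigma> \<circ> front n" by blast
  then show "\<pi> \<in> {\<pi> \<in> peakless (Suc n). \<pi> 1 = Suc n}"
    using comp_front_peakless permutes_not_in[OF peakless_permutes[OF \<sigma>(1)], of "Suc n"] by auto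
qed

text \<open>Anywhere but at an end, the largest entry would be a peak.\<close>

lemma peakless_Suc: "peakless (Suc n) = peakless n \<union> (\<lambda>\<sigma>. \<sigma> \<circ> front n) ` peakless n"
proof -
  have "\<pi> 1 = Suc n \<or> \<pi> (Suc n) = Suc n" if \<pi>: "\<pi> \<in> peakless (Suc n)" for \<pi>
  proof (rule ccontr)
    assume neg: "\<not> (\<pi> 1 = Suc n \<or> \<pi> (Suc n) = Suc n)"
    note p = peakless_permutes[OF \<pi>]
    obtain j where j: "\<pi> j = Suc n" using permutes_surj[OF p] by (metis surj_def)
    then have "j \<in> {1..Suc n}" using permutes_in_image[OF p, of j] by auto
    moreover have "j \<noteq> 1" "j \<noteq> Suc n" using neg j by auto
    ultimately have "1 < j" "j < Suc n" by auto
    moreover have "\<pi> 1 \<le> Suc n" "\<pi> (Suc n) \<le> Suc n" by (auto intro!: permutes_le[OF p])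
    ultimately have "\<pi> 1 < \<pi> j" "\<pi> (Suc n) < \<pi> j" using neg j by auto
    moreover have "\<not> (\<pi> 1 < \<pi> j \<and> \<pi> (Suc n) < \<pi> j)"
      using \<pi> \<open>1 < j\<close> \<open>j < Suc n\<close> unfolding peakless_def by blast
    ultimately show False by blast
  qed
  then have "peakless (Suc n) =
      {\<pi> \<in> peakless (Suc n). \<pi> (Suc n) = Suc n} \<union> {\<pi> \<in> peakless (Suc n). \<pi> 1 = Suc n}"
    by blast
  then show ?thesis unfolding peakless_max_last peakless_max_first .
qed

text \<open>For \<open>n = 0\<close> the two ends coincide and both constructions give the identity.\<close>

lemma peakless_Suc_disjoint:
  assumes "n \<ge> 1"
  shows "peakless n \<inter> (\<lambda>\<sigma>. \<sigma> \<circ> front n) ` peakless n = {}"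
proof -
  have "\<pi> 1 \<noteq> Suc n" if "\<pi> \<in> peakless n" for \<pi>
    using permutes_le[OF peakless_permutes[OF that] assms] by simp
  then show ?thesis unfolding peakless_max_first[symmetric] by blast
qed

lemma inj_comp_front: "inj_on (\<lambda>\<sigma>. \<sigma> \<circ> front n) A"
  by (rule inj_on_inverseI[where g = "\<lambda>\<pi>. \<pi> \<circ> inv (front n)"])
    (simp add: comp_assoc permutes_inv_o(1)[OF front_permutes])

section \<open>The recursion in length and shift\<close>

lemma DD_by_value:
  "DD n (int c) \<pi> = card {k \<in> {c + 1..n}. \<pi> (k - c) < k \<and> k < inv \<pi> k + c}"
proof -
  have "{k \<in> {c + 1..n}. \<pi> (k - c) < k \<and> k < inv \<pi> k + c} =
      (\<lambda>j. j + c) ` {j \<in> {1..n}. 1 \<le> int j + int c \<and> int j + int c \<le> int n \<and>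
        int (\<pi> j) < int j + int c \<and> int j + int c < int (inv \<pi> (nat (int j + int c))) + int c}"
    (is "?K = _ ` ?J")
  proof (intro set_eqI iffI)
    fix k assume k: "k \<in> ?K"
    then have "nat (int (k - c) + int c) = k" by auto
    then have "k - c \<in> ?J" using k by auto
    moreover have "k = k - c + c" using k by auto
    ultimately show "k \<in> (\<lambda>j. j + c) ` ?J" by blast
  next
    fix k assume "k \<in> (\<lambda>j. j + c) ` ?J"
    then obtain j where j: "j \<in> ?J" "k = j + c" by blast
    have "nat (int j + int c) = j + c" by simp
    then show "k \<in> ?K" using j by auto
  qed
  then show ?thesis unfolding DD_def by (simp add: card_image)
qed

text \<open>Only the value \<open>k = n+1\<close> is new. It counts as soon as it is admissible and its shifted position
  \<open>n+1-c\<close> is not its own, because the entry there is then smaller; for \<open>c = 0\<close> it is a fixed point.\<close>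

lemma DD_append_max:
  assumes p: "\<sigma> permutes {1..n}"
  shows "DD (Suc n) (int c) \<sigma> = DD n (int c) \<sigma> + (if 1 \<le> c \<and> c \<le> n then 1 else 0)"
proof -
  have fixed: "inv \<sigma> (Suc n) = Suc n"
    using permutes_not_in[OF permutes_inv[OF p], of "Suc n"] by simp
  have small: "\<sigma> (Suc n - c) < Suc n" if "1 \<le> c"
    using permutes_le[OF p, of "Suc n - c"] that by linarith
  have "{k \<in> {c + 1..Suc n}. \<sigma> (k - c) < k \<and> k < inv \<sigma> k + c} =
      {k \<in> {c + 1..n}. \<sigma> (k - c) < k \<and> k < inv \<sigma> k + c} \<union>
      (if 1 \<le> c \<and> c \<le> n then {Suc n} else {})"
    using fixed small by (auto simp: le_Suc_eq)
  then show ?thesis unfolding DD_by_value by (simp add: card_insert_if)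
qed

text \<open>For \<open>c + 1 < k \<le> n\<close> the defining inequalities on the two sides agree, since the entry at position
  \<open>k - c\<close> comes from position \<open>k - c - 1\<close> and the position of \<open>k\<close> grows by one. The two remaining
  values do not count: \<open>k = c + 1\<close> is compared with the entry \<open>n+1\<close> in front, and \<open>k = n+1\<close> has
  position \<open>1\<close>, which would require \<open>n + 1 < c + 1\<close>.\<close>

lemma DD_prepend_max:
  assumes p: "\<sigma> permutes {1..n}"
  shows "DD (Suc n) (int c) (\<sigma> \<circ> front n) = DD n (int (Suc c)) \<sigma>"
proof -
  have inv_comp: "inv (\<sigma> \<circ> front n) k = inv (front n) (inv \<sigma> k)" for k
    using o_inv_distrib[OF permutes_bij[OF p] permutes_bij[OF front_permutes]] by simp
  have inv_max: "inv \<sigma> (Suc n) = Suc n"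
    using permutes_not_in[OF permutes_inv[OF p], of "Suc n"] by simp
  have fixed: "\<sigma> (Suc n) = Suc n"
    using permutes_not_in[OF p, of "Suc n"] by simp
  have "(k \<in> {c + 1..Suc n} \<and> (\<sigma> \<circ> front n) (k - c) < k \<and> k < inv (\<sigma> \<circ> front n) k + c) \<longleftrightarrow>
      (k \<in> {Suc c + 1..n} \<and> \<sigma> (k - Suc c) < k \<and> k < inv \<sigma> k + Suc c)" for k
  proof -
    consider "k = c + 1" | "k = Suc n" | "k \<in> {Suc c + 1..n}" | "k \<notin> {c + 1..Suc n}"
      by fastforce
    then show ?thesis
    proof cases
      case 1
      then show ?thesis using fixed by auto
    next
      case 2
      then show ?thesis by (auto simp: inv_comp inv_max inv_front)
    next
      case 3
      then have "inv \<sigma> k \<in> {1..n}" using permutes_in_image[OF permutes_inv[OF p], of k] by auto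
      then have "inv (\<sigma> \<circ> front n) k = Suc (inv \<sigma> k)" by (simp add: inv_comp inv_front)
      moreover have "front n (k - c) = k - Suc c"
        using 3 front_shift[of "k - Suc c" n] by (auto simp: Suc_diff_Suc)
      ultimately show ?thesis using 3 by auto
    next
      case 4
      then show ?thesis by auto
    qed
  qed
  then show ?thesis unfolding DD_by_value by simp
qed

abbreviation X :: "int poly" where
  "X \<equiv> [:0, 1:]"

definition f :: "nat \<Rightarrow> nat \<Rightarrow> int poly" where
  "f n c = f_poly {[1,3,2], [2,3,1]} n c"

lemma f_eq_sum: "f n c = (\<Sum>\<pi>\<in>peakless n. X ^ DD n (int c) \<pi>)"
  unfolding f_def f_poly_def Av_eq_peakless ..

lemma f_Suc:
  assumes "n \<ge> 1"
  shows "f (Suc n) c = f n (Suc c) + X ^ (if 1 \<le> c \<and> c \<le> n then 1 else 0) * f n c"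
proof -
  let ?e = "if 1 \<le> c \<and> c \<le> n then 1 else 0 :: nat"
  have "f (Suc n) c = (\<Sum>\<pi>\<in>peakless n. X ^ DD (Suc n) (int c) \<pi>)
      + (\<Sum>\<pi>\<in>(\<lambda>\<sigma>. \<sigma> \<circ> front n) ` peakless n. X ^ DD (Suc n) (int c) \<pi>)"
    unfolding f_eq_sum peakless_Suc
    by (rule sum.union_disjoint)
      (use finite_peakless peakless_Suc_disjoint[OF assms] in auto)
  also have "(\<Sum>\<pi>\<in>peakless n. X ^ DD (Suc n) (int c) \<pi>) = X ^ ?e * f n c"
    unfolding f_eq_sum sum_distrib_left
    by (intro sum.cong refl)
      (simp only: DD_append_max[OF peakless_permutes] power_add mult.commute)
  also have "(\<Sum>\<pi>\<in>(\<lambda>\<sigma>. \<sigma> \<circ> front n) ` peakless n. X ^ DD (Suc n) (int c) \<pi>) = f n (Suc c)"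
    unfolding f_eq_sum sum.reindex[OF inj_comp_front] comp_apply
    by (intro sum.cong refl) (simp only: DD_prepend_max[OF peakless_permutes] o_def[symmetric])
  finally show ?thesis by (simp only: add.commute)
qed

lemma f_0: "f 0 c = 1"
proof -
  have "peakless 0 = {id}" by (auto simp: peakless_def)
  then show ?thesis by (simp add: f_eq_sum DD_by_value)
qed

lemma f_1: "f 1 c = 1"
proof -
  have "peakless 1 = {id}" by (auto simp: peakless_def)
  moreover have "DD 1 (int c) id = 0" unfolding DD_by_value by (cases c) auto
  ultimately show ?thesis by (simp add: f_eq_sum del: One_nat_def)
qed

text \<open>For \<open>n \<le> c\<close> the recursion without a factor \<open>X\<close> doubles, just as it does at \<open>X = 1\<close>.\<close>

lemma f_le_shift: "1 \<le> n \<Longrightarrow> n \<le> c \<Longrightarrow> f n c = 2 ^ (n - 1)"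
proof (induction n arbitrary: c rule: nat_induct_at_least)
  case base
  then show ?case by (simp add: f_1 del: One_nat_def)
next
  case (Suc n)
  then have "f (Suc n) c = f n (Suc c) + f n c" by (simp add: f_Suc)
  also have "\<dots> = 2 * 2 ^ (n - 1)" using Suc by simp
  finally show ?case using Suc.hyps by (cases n) simp_all
qed

lemma f_at_1: "1 \<le> n \<Longrightarrow> poly (f n c) 1 = 2 ^ (n - 1)"
proof (induction n arbitrary: c rule: nat_induct_at_least)
  case base
  then show ?case by (simp add: f_1 del: One_nat_def)
next
  case (Suc n)
  then have "poly (f (Suc n) c) 1 = 2 * 2 ^ (n - 1)"
    by (simp add: f_Suc)
  then show ?case using Suc.hyps by (cases n) simp_all
qed

section \<open>The recursion at shift zero\<close>

fun Q :: "nat \<Rightarrow> int poly" where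
  "Q 0 = 1"
| "Q (Suc 0) = X + 1"
| "Q (Suc (Suc m)) = X * Q (Suc m) + 2 * Q m"

text \<open>Adding \<open>1\<close> to the shift lowers \<open>m = n - c\<close> by \<open>2\<close> in the recursion and doubles the factor
  \<open>2\<^sup>c\<^sup>-\<^sup>1\<close>, whence the coefficient \<open>2\<close> of \<open>Q m\<close>. The shift is written \<open>c + 1\<close> because at shift \<open>0\<close> the
  factor \<open>X\<close> is absent.\<close>

lemma f_diagonal: "f (c + 1 + m) (c + 1) = 2 ^ c * Q m"
proof (induction m arbitrary: c rule: Q.induct)
  case 1
  show ?case by (simp add: f_le_shift)
next
  case 2
  have "f (Suc (c + 1)) (c + 1) = f (c + 1) (Suc (c + 1)) + X * f (c + 1) (c + 1)"
    by (subst f_Suc) auto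
  also have "\<dots> = 2 ^ c * (X + 1)" by (simp add: f_le_shift algebra_simps)
  finally show ?case by simp
next
  case (3 m)
  have "f (Suc (c + 1 + Suc m)) (c + 1)
      = f (c + 1 + Suc m) (Suc (c + 1)) + X * f (c + 1 + Suc m) (c + 1)"
    by (subst f_Suc) auto
  also have "f (c + 1 + Suc m) (Suc (c + 1)) = 2 ^ Suc c * Q m"
    using "3.IH"(2)[of "Suc c"] by simp
  also have "f (c + 1 + Suc m) (c + 1) = 2 ^ c * Q (Suc m)"
    by (rule "3.IH"(1))
  finally show ?case by (simp add: algebra_simps)
qed

lemma f_shift_0: "f (m + 2) 0 = Q m + f (m + 1) 0"
  using f_Suc[of "m + 1" 0] f_diagonal[of 0 m] by simp

lemma f_shift_0_recursion:
  assumes "n \<ge> 1"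
  shows "f (n + 3) 0 = (X + 1) * f (n + 2) 0 - (X - 2) * f (n + 1) 0 - 2 * f n 0"
proof -
  obtain m where n: "n = m + 1" using assms by (metis add.commute le_Suc_ex)
  have "f (n + 3) 0 - f (n + 2) 0 = Q (Suc (Suc m))"
    using f_shift_0[of "m + 2"] by (simp add: n eval_nat_numeral)
  moreover have "f (n + 2) 0 - f (n + 1) 0 = Q (Suc m)"
    using f_shift_0[of "m + 1"] by (simp add: n eval_nat_numeral)
  moreover have "f (n + 1) 0 - f n 0 = Q m"
    using f_shift_0[of m] by (simp add: n eval_nat_numeral)
  ultimately have "f (n + 3) 0 - f (n + 2) 0
      = X * (f (n + 2) 0 - f (n + 1) 0) + 2 * (f (n + 1) 0 - f n 0)"
    by (simp only: Q.simps)
  then show ?thesis by algebra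
qed

theorem mainTheorem10:
  fixes S :: "nat list set" and x :: "int poly"
  assumes S: "S = {[1,3,2], [2,3,1]}" and x: "x = [:0, 1:]"
  shows "(\<forall>c n. n \<ge> 2 \<and> n > c \<longrightarrow>
            f_poly S n c = f_poly S (n - 1) (c + 1)
              + x ^ (if n \<in> {c + 1..c + n - 1} then 1 else 0) * f_poly S (n - 1) c)
       \<and> (\<forall>c. f_poly S 0 c = 1 \<and> f_poly S 1 c = 1)
       \<and> (\<forall>c n. 1 \<le> n \<and> n \<le> c \<longrightarrow> f_poly S n c = 2 ^ (n - 1))
       \<and> (\<forall>c n. 1 \<le> n \<longrightarrow> poly (f_poly S n c) 1 = 2 ^ (n - 1))
       \<and> (\<forall>n\<ge>1. f_poly S (n + 3) 0 =
            (x + 1) * f_poly S (n + 2) 0 - (x - 2) * f_poly S (n + 1) 0 - 2 * f_poly S n 0)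
       \<and> f_poly S 0 0 = 1 \<and> f_poly S 1 0 = 1 \<and> f_poly S 2 0 = 2 \<and> f_poly S 3 0 = x + 3"
proof -
  have rec: "f n c = f (n - 1) (c + 1)
      + X ^ (if n \<in> {c + 1..c + n - 1} then 1 else 0) * f (n - 1) c"
    if "n \<ge> 2 \<and> n > c" for n c
  proof -
    have "n \<in> {c + 1..c + n - 1} \<longleftrightarrow> 1 \<le> c \<and> c \<le> n - 1" using that by auto
    moreover have "n = Suc (n - 1)" "n - 1 \<ge> 1" using that by auto
    ultimately show ?thesis using f_Suc[of "n - 1" c] by (simp only: Suc_eq_plus1)
  qed
  have f2: "f 2 0 = 2"
    using f_shift_0[of 0] f_1[of 0] by (simp add: eval_nat_numeral)
  have f3: "f 3 0 = X + 3"
    using f_shift_0[of 1] f2 by (simp add: eval_nat_numeral)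
  show ?thesis
    unfolding S x f_def[symmetric]
    using rec f_0 f_1 f_le_shift f_at_1 f_shift_0_recursion f2 f3
    by blast
qed

end
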